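(* Let $A$ be a C*-algebra. Then the following three statements are equivalent: $A$ is finite dimensional; the poset $\mathcal{C}(A)$ is Artinian; the poset $\mathcal{C}(A)$ is Noetherian.
   Context: All C*-algebras are assumed to be unital. For a C*-algebra $A$ with unit $1_A$, $\mathcal{C}(A)$ denotes the set of all commutative C*-subalgebras of $A$ that contain $1_A$, partially ordered by inclusion. A poset $P$ is called Artinian if it satisfies the descending chain condition: for each sequence $C_1\geq C_2\geq\cdots$ in $P$ there is an $n\in\mathbb{N}$ such that $C_k=C_n$ for all $k>n$ (equivalently, every non-empty subset of $P$ contains a minimal element; equivalently, every non-empty filtered subset of $P$ has a least element). A poset $P$ is called Noetherian if it satisfies the ascending chain condition: for each sequence $C_1\leq C_2\leq\cdots$ in $P$ there is an $n\in\mathbb{N}$ such that $C_k=C_n$ for all $k>n$ (equivalently, every non-empty subset of $P$ contains a maximal element; equivalently, every non-empty directed subset of $P$ has a greatest element). *)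

theory Defs
  imports "HOL-Analysis.Analysis"
begin

section \<open>Unital C*-algebras\<close>

text \<open>
  The real scalar multiplication inherited from \<^class>\<open>real_normed_algebra\<close> is forced to be the
  restriction of the complex one. The unit comes from \<^class>\<open>monoid_mult\<close> rather than from
  \<^class>\<open>real_normed_algebra_1\<close>, so that the zero algebra is not excluded; in a nonzero C*-algebra
  the C*-identity gives norm one for the unit.
\<close>

class cstar_algebra = real_normed_algebra + banach + monoid_mult +
  fixes scaleC :: "complex \<Rightarrow> 'a \<Rightarrow> 'a"  (infixr \<open>*\<^sub>C\<close> 75)
    and star :: "'a \<Rightarrow> 'a"
  assumes scaleR_scaleC: "r *\<^sub>R x = complex_of_real r *\<^sub>C x"
    and scaleC_add_right: "c *\<^sub>C (x + y) = c *\<^sub>C x + c *\<^sub>C y"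
    and scaleC_add_left: "(c + d) *\<^sub>C x = c *\<^sub>C x + d *\<^sub>C x"
    and scaleC_scaleC: "c *\<^sub>C d *\<^sub>C x = (c * d) *\<^sub>C x"
    and scaleC_one: "1 *\<^sub>C x = x"
    and mult_scaleC_left: "(c *\<^sub>C x) * y = c *\<^sub>C (x * y)"
    and mult_scaleC_right: "x * (c *\<^sub>C y) = c *\<^sub>C (x * y)"
    and norm_scaleC: "norm (c *\<^sub>C x) = cmod c * norm x"
    and star_star: "star (star x) = x"
    and star_add: "star (x + y) = star x + star y"
    and star_scaleC: "star (c *\<^sub>C x) = cnj c *\<^sub>C star x"
    and star_mult: "star (x * y) = star y * star x"
    and cstar_identity: "norm (star x * x) = (norm x)\<^sup>2"

global_interpretation complex_vector: vector_space "scaleC :: complex \<Rightarrow> 'a::cstar_algebra \<Rightarrow> 'a"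
  defines cspan = complex_vector.span
  by unfold_locales
    (rule scaleC_add_right scaleC_add_left scaleC_scaleC scaleC_one)+

definition cfinite_dimensional :: "'a::cstar_algebra set \<Rightarrow> bool" where
  "cfinite_dimensional V \<longleftrightarrow> (\<exists>B. finite B \<and> cspan B = V)"

section \<open>The poset of commutative unital C*-subalgebras\<close>

definition cstar_subalgebra :: "'a::cstar_algebra set \<Rightarrow> bool" where
  "cstar_subalgebra C \<longleftrightarrow>
     0 \<in> C \<and>
     (\<forall>x\<in>C. \<forall>y\<in>C. x + y \<in> C) \<and>
     (\<forall>c. \<forall>x\<in>C. c *\<^sub>C x \<in> C) \<and>
     (\<forall>x\<in>C. \<forall>y\<in>C. x * y \<in> C) \<and>
     (\<forall>x\<in>C. star x \<in> C) \<and>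
     closed C"

text \<open>Ordered by inclusion, which is the order \<open>\<le>\<close> on the type \<^typ>\<open>'a set\<close>.\<close>

definition comm_subalgebras :: "'a::cstar_algebra set set" where
  "comm_subalgebras =
     {C. cstar_subalgebra C \<and> 1 \<in> C \<and> (\<forall>x\<in>C. \<forall>y\<in>C. x * y = y * x)}"

section \<open>Chain conditions\<close>

definition artinian_poset :: "'a::order set \<Rightarrow> bool" where
  "artinian_poset P \<longleftrightarrow>
     (\<forall>C :: nat \<Rightarrow> 'a. (\<forall>i. C i \<in> P) \<and> decseq C \<longrightarrow> (\<exists>n. \<forall>k>n. C k = C n))"

definition noetherian_poset :: "'a::order set \<Rightarrow> bool" where
  "noetherian_poset P \<longleftrightarrow>
     (\<forall>C :: nat \<Rightarrow> 'a. (\<forall>i. C i \<in> P) \<and> incseq C \<longrightarrow> (\<exists>n. \<forall>k>n. C k = C n))"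

end

(* A commutative *-subalgebra generated by infinitely many nonzero pairwise orthogonal self-adjoint
   elements b_0, b_1, ... violates both chain conditions: consider its elements that act as one and the
   same scalar on the b_i with i >= n, respectively with i <= n. If there is no such sequence, halving
   corners terminates, so every corner contains a minimal projection e, for which eAe consists of
   scalars; finitely many of these sum to 1, and each e_i A e_j has dimension at most one. Instead of
   the continuous functional calculus only square roots are used. *)

theory Submission
  imports Defs
begin

section \<open>Elementary consequences of the axioms\<close>

text \<open>The obstacle is that no projection is given in advance: the algebra C[0,1] has only the
  trivial ones. Hence corners are formed with arbitrary self-adjoint elements, and the halving works
  with self-adjoint elements too; a projection appears only where it stops, because in a corner
  without orthogonal pairs the square of a normalised element is forced to be idempotent. Each
  square root comes with the clause that it commutes with whatever commutes with the given element;
  this stands in for membership in the generated algebra. The chains are cut out of the bicommutant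
  of the orthogonal sequence, so that no generated algebra has to be closed up by hand. In the
  converse direction a strict inclusion of subspaces strictly raises a bounded dimension.\<close>

lemma star_zero [simp]: "star (0 :: 'a::cstar_algebra) = 0"
  using star_add[of "0::'a" 0] by simp

lemma star_minus: "star (- x) = - star (x :: 'a::cstar_algebra)"
  using star_add[of x "- x"] by (simp add: eq_neg_iff_add_eq_0 add.commute)

lemma star_diff: "star (x - y) = star x - star (y :: 'a::cstar_algebra)"
  using star_add[of x "- y"] by (simp add: star_minus)

lemma star_scaleR: "star (r *\<^sub>R x) = r *\<^sub>R star (x :: 'a::cstar_algebra)"
  by (simp add: scaleR_scaleC star_scaleC)

lemma star_one [simp]: "star (1 :: 'a::cstar_algebra) = 1"
  using star_mult[of "star 1" "1::'a"] by (simp add: star_star)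

lemma star_sum: "star (\<Sum>i\<in>I. f i) = (\<Sum>i\<in>I. star (f i :: 'a::cstar_algebra))"
  by (induction I rule: infinite_finite_induct) (simp_all add: star_add)

text \<open>That \<open>star\<close> is isometric is not an axiom: the C*-identity and
  submultiplicativity bound the square of \<open>norm x\<close> by
  \<open>norm (star x) * norm x\<close>, and one factor cancels.\<close>

lemma norm_le_norm_star: "norm x \<le> norm (star (x :: 'a::cstar_algebra))"
proof (cases "x = 0")
  case False
  have "norm x * norm x \<le> norm (star x) * norm x"
    using norm_mult_ineq[of "star x" x] by (simp add: cstar_identity power2_eq_square)
  with False show ?thesis by simp
qed simp

lemma norm_star [simp]: "norm (star x) = norm (x :: 'a::cstar_algebra)"
  using norm_le_norm_star[of x] norm_le_norm_star[of "star x"] by (simp add: star_star)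

lemma tendsto_star:
  fixes x :: "'a::cstar_algebra"
  assumes "(f \<longlongrightarrow> x) F"
  shows "((\<lambda>n. star (f n)) \<longlongrightarrow> star x) F"
  using assms by (simp add: tendsto_iff dist_norm flip: star_diff)

lemma norm_square_selfadjoint:
  "star x = x \<Longrightarrow> norm (x * x) = (norm (x :: 'a::cstar_algebra))\<^sup>2"
  using cstar_identity[of x] by simp

lemma selfadjoint_square_eq_0_iff:
  "star x = x \<Longrightarrow> x * x = 0 \<longleftrightarrow> x = (0 :: 'a::cstar_algebra)"
  using norm_square_selfadjoint[of x] by auto

lemma star_mult_self_eq_0_iff: "star x * x = 0 \<longleftrightarrow> x = (0 :: 'a::cstar_algebra)"
  using cstar_identity[of x] by auto

lemma norm_one_le: "norm (1 :: 'a::cstar_algebra) \<le> 1"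
  using norm_square_selfadjoint[of "1::'a"]
  by (cases "norm (1::'a) = 0") (simp_all add: power2_eq_square)

lemma tendsto_scaleC:
  fixes f :: "nat \<Rightarrow> complex"
  assumes "f \<longlonglongrightarrow> l"
  shows "(\<lambda>n. f n *\<^sub>C (x :: 'a::cstar_algebra)) \<longlonglongrightarrow> l *\<^sub>C x"
proof -
  have "(\<lambda>n. norm (f n - l)) \<longlonglongrightarrow> 0"
    using assms by (simp add: LIM_zero tendsto_norm_zero)
  then have "(\<lambda>n. norm (f n - l) * norm x) \<longlonglongrightarrow> 0"
    by (rule tendsto_mult_left_zero)
  then have "(\<lambda>n. norm (f n *\<^sub>C x - l *\<^sub>C x)) \<longlonglongrightarrow> 0"
    by (simp add: norm_scaleC flip: complex_vector.scale_left_diff_distrib)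
  then show ?thesis
    by (rule LIM_zero_cancel[OF tendsto_norm_zero_cancel])
qed

section \<open>Square roots\<close>

text \<open>Since \<open>a + \<i>b\<close> is normal, \<open>a\<^sup>2 + b\<^sup>2\<close> is its modulus squared, and \<open>a\<close> is its real part.\<close>

lemma norm_square_le_norm_sum_squares:
  fixes a b :: "'a::cstar_algebra"
  assumes a: "star a = a" and b: "star b = b" and ab: "a * b = b * a"
  shows "(norm a)\<^sup>2 \<le> norm (a * a + b * b)"
proof -
  define z where "z = a + \<i> *\<^sub>C b"
  have sz: "star z = a - \<i> *\<^sub>C b"
    by (simp add: z_def star_add star_scaleC a b)
  have "star z * z = a * a + b * b"
    unfolding sz unfolding z_def
    by (simp add: algebra_simps mult_scaleC_left mult_scaleC_right scaleC_scaleC ab scaleC_one)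
  then have n: "norm (a * a + b * b) = (norm z)\<^sup>2"
    by (metis cstar_identity)
  have "2 *\<^sub>R a = z + star z"
    unfolding sz unfolding z_def by (simp add: scaleR_2)
  then have "2 * norm a \<le> norm z + norm (star z)"
    by (metis norm_triangle_ineq norm_scaleR abs_numeral)
  then have "norm a \<le> norm z" by simp
  then show ?thesis by (simp add: n power_mono)
qed

text \<open>The solution of \<open>y = (x + y\<^sup>2) / 2\<close>, that is \<open>1 - \<surd>(1 - x)\<close>, is the limit of the iteration
  started at \<open>0\<close>; the increments are dominated by those of the same iteration for the number \<open>1\<close>.\<close>

lemma sqrt_one_minus_exists:
  fixes x :: "'a::cstar_algebra"
  assumes x: "norm x \<le> 1" and sx: "star x = x"
  obtains y where "norm y \<le> 1" "(1 - y) * (1 - y) = 1 - x" "star y = y"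
    "\<And>z. z * x = x * z \<Longrightarrow> z * y = y * z"
proof -
  define Y where "Y = rec_nat (0::'a) (\<lambda>_ y. (1/2) *\<^sub>R (x + y * y))"
  define T where "T = rec_nat (0::real) (\<lambda>_ t. (1/2) * (1 + t * t))"
  have Y0: "Y 0 = 0" and YS: "Y (Suc n) = (1/2) *\<^sub>R (x + Y n * Y n)" for n
    by (simp_all add: Y_def)
  have T0: "T 0 = 0" and TS: "T (Suc n) = (1/2) * (1 + T n * T n)" for n
    by (simp_all add: T_def)
  have T_bounds: "0 \<le> T n \<and> T n \<le> 1" for n
  proof (induction n)
    case (Suc n)
    then have "T n * T n \<le> 1" by (simp add: mult_le_one)
    then show ?case by (simp add: TS)
  qed (simp add: T0)
  \<comment> \<open>The increment \<open>T (Suc n) - T n\<close> is half the square of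
    \<open>T n - 1\<close>.\<close>
  have T_mono: "T n \<le> T (Suc n)" for n
    using sum_squares_ge_zero[of "T n - 1" 0] by (simp add: TS algebra_simps)
  have "convergent T"
    using T_bounds T_mono
    by (intro Bseq_monoseq_convergent BseqI'[of _ 1])
       (auto simp: monoseq_Suc)
  then have T_Cauchy: "Cauchy T" by (simp add: convergent_Cauchy)
  have Y_commute: "z * Y n = Y n * z" if "z * x = x * z" for z n
  proof (induction n)
    case (Suc n)
    then show ?case
      using that by (simp add: YS algebra_simps) (metis mult.assoc)
  qed (simp add: Y0)
  have YY: "Y m * Y n = Y n * Y m" for m n
    by (metis Y_commute)
  have Y_norm: "norm (Y n) \<le> T n" for n
  proof (induction n)
    case (Suc n)
    have "norm (Y n * Y n) \<le> T n * T n"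
      using norm_mult_ineq[of "Y n" "Y n"] mult_mono[OF Suc Suc] T_bounds[of n] by simp
    then show ?case
      using norm_triangle_ineq[of x "Y n * Y n"] x by (simp add: YS TS)
  qed (simp add: Y0 T0)
  have Y_step: "norm (Y (Suc n) - Y n) \<le> T (Suc n) - T n" for n
  proof (induction n)
    case 0
    then show ?case using x by (simp add: Y0 T0 YS TS)
  next
    case (Suc n)
    \<comment> \<open>Difference of squares, valid because the iterates commute with each
      other.\<close>
    have "(1/2) *\<^sub>R ((Y (Suc n) - Y n) * (Y (Suc n) + Y n))
        = (1/2) *\<^sub>R (x + Y (Suc n) * Y (Suc n)) - (1/2) *\<^sub>R (x + Y n * Y n)"
      using YY[of n "Suc n"] by (simp add: algebra_simps)
    then have eq: "Y (Suc (Suc n)) - Y (Suc n) = (1/2) *\<^sub>R ((Y (Suc n) - Y n) * (Y (Suc n) + Y n))"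
      by (simp only: YS)
    have "norm (Y (Suc n) + Y n) \<le> T (Suc n) + T n"
      using norm_triangle_ineq[of "Y (Suc n)" "Y n"] Y_norm[of n] Y_norm[of "Suc n"] by simp
    then have "norm ((Y (Suc n) - Y n) * (Y (Suc n) + Y n)) \<le> (T (Suc n) - T n) * (T (Suc n) + T n)"
      using norm_mult_ineq[of "Y (Suc n) - Y n" "Y (Suc n) + Y n"]
        mult_mono[OF Suc] T_mono[of n] by fastforce
    moreover have "T (Suc (Suc n)) - T (Suc n) = (1/2) * ((T (Suc n) - T n) * (T (Suc n) + T n))"
      by (simp only: TS[of "Suc n"] TS[of n]) (simp add: TS field_simps)
    ultimately show ?case by (simp add: eq)
  qed
  have Y_diff: "norm (Y n - Y m) \<le> T n - T m" if "m \<le> n" for m n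
    using that
  proof (induction n rule: dec_induct)
    case (step n)
    then show ?case
      using norm_triangle_ineq[of "Y (Suc n) - Y n" "Y n - Y m"] Y_step[of n] by simp
  qed simp
  have "Cauchy Y"
  proof (rule metric_CauchyI)
    fix e :: real assume "0 < e"
    with T_Cauchy obtain M where M: "\<And>m n. m \<ge> M \<Longrightarrow> n \<ge> M \<Longrightarrow> dist (T m) (T n) < e"
      unfolding Cauchy_def by blast
    show "\<exists>M. \<forall>m\<ge>M. \<forall>n\<ge>M. dist (Y m) (Y n) < e"
    proof (intro exI allI impI)
      fix m n assume mn: "M \<le> m" "M \<le> n"
      show "dist (Y m) (Y n) < e"
      proof (cases "m \<le> n")
        case True
        then show ?thesis
          using Y_diff[of m n] M[OF mn] by (simp add: dist_norm norm_minus_commute)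
      next
        case False
        then show ?thesis
          using Y_diff[of n m] M[OF mn] by (simp add: dist_norm)
      qed
    qed
  qed
  then obtain y where y: "Y \<longlonglongrightarrow> y"
    by (auto simp: Cauchy_convergent_iff convergent_def)
  have fix_y: "y = (1/2) *\<^sub>R (x + y * y)"
  proof (rule LIMSEQ_unique)
    show "(\<lambda>n. Y (Suc n)) \<longlonglongrightarrow> y" using y by (rule LIMSEQ_Suc)
    show "(\<lambda>n. Y (Suc n)) \<longlonglongrightarrow> (1/2) *\<^sub>R (x + y * y)"
      unfolding YS by (intro tendsto_intros y)
  qed
  have "star (Y n) = Y n" for n
    by (induction n) (simp_all add: Y0 YS star_scaleR star_add star_mult sx)
  then have "star y = y"
    using LIMSEQ_unique[OF tendsto_star[OF y], of y] y by simp
  moreover have "norm y \<le> 1"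
    using T_bounds Y_norm by (intro LIMSEQ_le_const2[OF tendsto_norm[OF y]]) (meson order_trans)
  moreover have "(1 - y) * (1 - y) = 1 - x"
  proof -
    have "y + y = x + y * y"
      using arg_cong[OF fix_y, of "\<lambda>u. 2 *\<^sub>R u"] by (simp add: scaleR_2)
    then show ?thesis by (simp add: algebra_simps)
  qed
  moreover have "z * y = y * z" if "z * x = x * z" for z
  proof (rule LIMSEQ_unique)
    show "(\<lambda>n. z * Y n) \<longlonglongrightarrow> z * y" by (intro tendsto_intros y)
    show "(\<lambda>n. z * Y n) \<longlonglongrightarrow> y * z"
      unfolding Y_commute[OF that] by (intro tendsto_intros y)
  qed
  ultimately show ?thesis using that by blast
qed

lemma sqrt_one_minus_square_exists:
  fixes x :: "'a::cstar_algebra"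
  assumes "norm x \<le> 1" "star x = x"
  obtains s where "s * s = 1 - x * x" "star s = s" "\<And>z. z * x = x * z \<Longrightarrow> z * s = s * z"
proof -
  have "norm (x * x) \<le> 1"
    using assms by (simp add: norm_square_selfadjoint power_le_one)
  then obtain y where y: "(1 - y) * (1 - y) = 1 - x * x" "star y = y"
    "\<And>z. z * (x * x) = (x * x) * z \<Longrightarrow> z * y = y * z"
    using sqrt_one_minus_exists[of "x * x"] assms by (metis star_mult)
  have comm: "z * (1 - y) = (1 - y) * z" if "z * x = x * z" for z
  proof -
    have "z * (x * x) = (x * x) * z" using that by (metis mult.assoc)
    then show ?thesis using y(3) by (simp add: algebra_simps)
  qed
  have "star (1 - y) = 1 - y" by (simp add: star_diff y(2))
  with y(1) show ?thesis using comm by (rule that)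
qed

text \<open>\<open>r * r\<close> is the absolute value of \<open>k\<close>.\<close>

lemma sqrt_abs_exists:
  fixes k :: "'a::cstar_algebra"
  assumes k: "star k = k"
  obtains r where "r * r * (r * r) = k * k" "star r = r" "\<And>z. z * k = k * z \<Longrightarrow> z * r = r * z"
proof (cases "k = 0")
  case True
  then show ?thesis using that[of 0] by simp
next
  case False
  define c where "c = norm k"
  have c: "c > 0" using False by (simp add: c_def)
  define h where "h = (1 / c) *\<^sub>R k"
  have h: "norm h \<le> 1" "star h = h" "k = c *\<^sub>R h"
    using c k by (simp_all add: h_def star_scaleR) (simp add: c_def)
  obtain s where s: "s * s = 1 - h * h" "star s = s" "\<And>z. z * h = h * z \<Longrightarrow> z * s = s * z"
    using sqrt_one_minus_square_exists[OF h(1,2)] by blast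
  \<comment> \<open>As \<open>s * s + h * h = 1\<close>, this bounds \<open>s * s\<close> by one, so
    the square root construction applies to it again.\<close>
  have "(norm s)\<^sup>2 \<le> norm (s * s + h * h)"
    using s h(2) by (intro norm_square_le_norm_sum_squares) (metis)+
  also have "\<dots> \<le> 1" using norm_one_le[where ?'a = 'a] by (simp add: s)
  finally have "norm (s * s) \<le> 1" by (simp only: norm_square_selfadjoint[OF s(2)])
  then obtain y where y: "norm y \<le> 1" "(1 - y) * (1 - y) = 1 - s * s" "star y = y"
    "\<And>z. z * (s * s) = s * s * z \<Longrightarrow> z * y = y * z"
    using sqrt_one_minus_exists[of "s * s"] s(2) by (metis star_mult)
  obtain w where w: "(1 - w) * (1 - w) = 1 - y" "star w = w"
    "\<And>z. z * y = y * z \<Longrightarrow> z * w = w * z"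
    using sqrt_one_minus_exists[OF y(1,3)] by metis
  \<comment> \<open>Here \<open>1 - y\<close> is the absolute value of \<open>h\<close>, since its
    square is \<open>1 - s * s = h * h\<close>, and \<open>1 - w\<close> is a square root of that.
    The factor \<open>sqrt c\<close> undoes the normalisation of \<open>k\<close>.\<close>
  define r where "r = sqrt c *\<^sub>R (1 - w)"
  have rr: "r * r = c *\<^sub>R (1 - y)"
    using c by (simp add: r_def w)
  have "r * r * (r * r) = (c * c) *\<^sub>R ((1 - y) * (1 - y))"
    unfolding rr by simp
  also have "\<dots> = k * k" unfolding y h(3) s by simp
  finally have "r * r * (r * r) = k * k" .
  moreover have "star r = r" by (simp add: r_def star_scaleR star_diff w)
  moreover have "z * r = r * z" if "z * k = k * z" for z
  proof -
    have "z * h = h * z" using that by (simp add: h_def)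
    then have "z * (s * s) = s * s * z" using s(3) by (metis mult.assoc)
    then have "z * w = w * z" using w(3) y(4) by blast
    then show ?thesis by (simp add: r_def algebra_simps)
  qed
  ultimately show ?thesis by (rule that)
qed

text \<open>Together with associativity this lets simp sort products of commuting factors.\<close>

lemma commute_left:
  fixes a :: "'a::semigroup_mult"
  assumes "a * b = b * a"
  shows "a * (b * z) = b * (a * z)"
  by (simp add: assms flip: mult.assoc)

section \<open>Corners without orthogonal elements\<close>

text \<open>For a projection \<open>m\<close> this is the usual corner. For other \<open>m\<close>
  it need be neither closed nor contain \<open>m\<close>, but it still absorbs the corners of its
  elements.\<close>

definition corner :: "'a::cstar_algebra \<Rightarrow> 'a set" where
  "corner m = range (\<lambda>x. m * x * m)"

lemma cornerI: "m * x * m \<in> corner m"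
  by (simp add: corner_def)

lemma corner_subset:
  assumes "x \<in> corner m"
  shows "corner x \<subseteq> corner m"
proof -
  obtain u where u: "x = m * u * m" using assms by (auto simp: corner_def)
  have "x * y * x = m * (u * m * y * m * u) * m" for y
    by (simp add: u mult.assoc)
  then show ?thesis unfolding corner_def by auto
qed

lemma corner_orthogonal:
  assumes "x \<in> corner m" "m * y = 0"
  shows "x * y = 0"
  using assms unfolding corner_def by (auto simp: mult.assoc)

lemma corner_orthogonal':
  assumes "x \<in> corner m" "y * m = 0"
  shows "y * x = 0"
  using assms unfolding corner_def by (auto simp flip: mult.assoc)

text \<open>The stopping condition of the halving: its failure yields exactly the two elements with
  which a corner is split.\<close>

definition orthogonal_free :: "'a::cstar_algebra set \<Rightarrow> bool" where
  "orthogonal_free S \<longleftrightarrow>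
     (\<forall>x\<in>S. \<forall>y\<in>S. star x = x \<longrightarrow> star y = y \<longrightarrow> x * y = 0 \<longrightarrow> x = 0 \<or> y = 0)"

lemma orthogonal_free_mono: "S \<subseteq> T \<Longrightarrow> orthogonal_free T \<Longrightarrow> orthogonal_free S"
  unfolding orthogonal_free_def by blast

text \<open>Splitting \<open>x\<^sup>2 - t\<close> into its positive and negative part for every \<open>t < 1\<close> shows that \<open>x\<^sup>2\<close> has no
  spectrum strictly between \<open>0\<close> and \<open>1\<close>.\<close>

lemma orthogonal_free_imp_idempotent_square:
  fixes x :: "'a::cstar_algebra"
  assumes x: "star x = x" "norm x = 1" and free: "orthogonal_free (corner x)"
  shows "x * x * (x * x) = x * x"
proof -
  obtain s where s: "s * s = 1 - x * x" "star s = s" "x * s = s * x"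
    using sqrt_one_minus_square_exists[of x] x by (metis order_refl)
  have xs: "(x * s) * (x * s) = x * x - x * x * (x * x)"
  proof -
    have "(x * s) * (x * s) = x * x * (s * s)"
      by (simp add: mult.assoc s(3) commute_left[OF s(3)])
    then show ?thesis by (simp add: s algebra_simps)
  qed
  have star_xs: "star (x * s) = x * s" by (simp add: star_mult s x)
  \<comment> \<open>The aim is \<open>x * s = 0\<close>, which by \<open>xs\<close> is the claim; it
    follows by letting \<open>t\<close> tend to 1.\<close>
  have bound: "(norm (x * s))\<^sup>2 \<le> 1 - t" if t: "0 < t" "t < 1" for t
  proof -
    define k where "k = x * x - t *\<^sub>R 1"
    have k: "star k = k" "x * k = k * x"
      by (simp_all add: k_def star_diff star_mult star_scaleR x algebra_simps)
    obtain r where r: "r * r * (r * r) = k * k" "star r = r" and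
      comm: "\<And>z. z * k = k * z \<Longrightarrow> z * r = r * z"
      using sqrt_abs_exists[OF k(1)] by metis
    have xr: "x * r = r * x" and kr: "k * r = r * k" and sr: "s * r = r * s"
    proof -
      show "x * r = r * x" "k * r = r * k" using comm k by auto
      have "s * k = k * s"
        by (simp add: k_def algebra_simps s(3) commute_left[OF s(3)])
      then show "s * r = r * s" by (rule comm)
    qed
    \<comment> \<open>As \<open>r * r\<close> is the absolute value of \<open>k\<close>, these are
      twice the positive and twice the negative part of \<open>k\<close>. Compressed by
      \<open>x\<close> they are orthogonal elements of the corner, so one of them vanishes.\<close>
    define p where "p = r * r + k"
    define q where "q = r * r - k"
    have pq: "p * q = 0"
      using r(1) by (simp add: p_def q_def algebra_simps kr commute_left[OF kr])
    have xp: "x * p = p * x" and xq: "x * q = q * x"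
      by (simp_all add: p_def q_def algebra_simps k(2) xr commute_left[OF xr])
    have "(x * p * x) * (x * q * x) = x * x * (p * q) * (x * x)"
      by (simp add: mult.assoc xp xq commute_left[OF xp] commute_left[OF xq])
    then have "(x * p * x) * (x * q * x) = 0" by (simp add: pq)
    moreover have "star (x * p * x) = x * p * x" "star (x * q * x) = x * q * x"
      by (simp_all add: star_mult x p_def q_def star_add star_diff r k mult.assoc)
    ultimately have "x * p * x = 0 \<or> x * q * x = 0"
      using free cornerI[of x p] cornerI[of x q] unfolding orthogonal_free_def by blast
    then have split: "x * (r * r) * x + x * k * x = 0 \<or> x * (r * r) * x - x * k * x = 0"
      by (simp add: p_def q_def distrib_left distrib_right left_diff_distrib right_diff_distrib)
    have xrr: "(x * r) * (x * r) = x * (r * r) * x"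
      by (simp add: mult.assoc xr commute_left[OF xr])
    have star_xr: "star (x * r) = x * r" by (simp add: star_mult r x xr)
    consider "(x * r) * (x * r) = - (x * k * x)" | "(x * r) * (x * r) = x * k * x"
      using split unfolding xrr by (auto simp: eq_neg_iff_add_eq_0)
    then show ?thesis
    proof cases
      case 1
      \<comment> \<open>Norms would give \<open>1 <= t\<close>, because \<open>x * x\<close> has
        norm one.\<close>
      have "x * x * (x * x) + (x * r) * (x * r) = t *\<^sub>R (x * x)"
        unfolding 1 by (simp add: k_def algebra_simps)
      moreover have "x * x * (x * r) = x * r * (x * x)"
        by (simp add: mult.assoc xr commute_left[OF xr])
      ultimately have "(norm (x * x))\<^sup>2 \<le> norm (t *\<^sub>R (x * x))"
        using norm_square_le_norm_sum_squares[of "x * x" "x * r"] star_xr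
        by (simp add: star_mult x)
      then have False using t by (simp add: norm_square_selfadjoint x)
      then show ?thesis ..
    next
      case 2
      \<comment> \<open>The terms of degree four in \<open>x\<close> cancel, leaving a multiple of
        \<open>x * x\<close> of norm \<open>1 - t\<close>.\<close>
      have "(x * s) * (x * s) + (x * r) * (x * r) = (1 - t) *\<^sub>R (x * x)"
        unfolding 2 xs by (simp add: k_def algebra_simps)
      moreover have "x * s * (x * r) = x * r * (x * s)"
        by (simp add: mult.assoc xr s(3) sr commute_left[OF xr] commute_left[OF s(3)] commute_left[OF sr])
      ultimately have "(norm (x * s))\<^sup>2 \<le> norm ((1 - t) *\<^sub>R (x * x))"
        using norm_square_le_norm_sum_squares[of "x * s" "x * r"] star_xr star_xs by simp
      then show ?thesis using t by (simp add: norm_square_selfadjoint x)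
    qed
  qed
  \<comment> \<open>Capping \<open>e\<close> at 1/2 keeps \<open>t = 1 - min e (1/2)\<close>
    strictly between 0 and 1.\<close>
  have "(norm (x * s))\<^sup>2 \<le> 0 + e" if "e > 0" for e
    using bound[of "1 - min e (1/2)"] that by (cases "e \<le> 1/2") (simp_all add: min_def)
  then have "(norm (x * s))\<^sup>2 \<le> 0" by (rule field_le_epsilon)
  then have "x * s = 0" by simp
  then show ?thesis using xs by simp
qed

section \<open>Minimal projections and their corners\<close>

definition minimal_projection :: "'a::cstar_algebra \<Rightarrow> bool" where
  "minimal_projection e \<longleftrightarrow>
     star e = e \<and> e * e = e \<and> e \<noteq> 0 \<and> orthogonal_free (corner e)"

lemma minimal_projectionD:
  assumes "minimal_projection e"
  shows "star e = e" "e * e = e" "e * (e * x) = e * x" "e \<noteq> 0" "orthogonal_free (corner e)"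
  using assms unfolding minimal_projection_def by (auto simp flip: mult.assoc)

text \<open>The projection is the square of the normalised \<open>m\<close>: idempotent by the
  preceding lemma on squares, and nonzero because its norm is one.\<close>

lemma orthogonal_free_imp_minimal_projection:
  fixes m :: "'a::cstar_algebra"
  assumes m: "star m = m" "m \<noteq> 0" "orthogonal_free (corner m)"
  obtains e where "minimal_projection e" "e \<in> corner m"
proof -
  define x where "x = (1 / norm m) *\<^sub>R m"
  have x: "star x = x" "norm x = 1"
    using m by (simp_all add: x_def star_scaleR)
  have "x * u * x = m * ((1 / norm m * (1 / norm m)) *\<^sub>R u) * m" for u
    by (simp add: x_def)
  then have sub: "corner x \<subseteq> corner m"
    unfolding corner_def by blast
  have idem: "x * x * (x * x) = x * x"
    using x orthogonal_free_mono[OF sub m(3)] by (rule orthogonal_free_imp_idempotent_square)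
  have mem: "x * x \<in> corner m"
    using sub cornerI[of x 1] by auto
  have "norm (x * x) = 1" using x by (simp add: norm_square_selfadjoint)
  then have "x * x \<noteq> 0" by auto
  then have "minimal_projection (x * x)"
    unfolding minimal_projection_def
    using idem x(1) orthogonal_free_mono[OF corner_subset[OF mem] m(3)] by (simp add: star_mult)
  with mem show ?thesis using that by blast
qed

lemma corner_projection:
  assumes "e * e = e"
  shows "x \<in> corner e \<longleftrightarrow> e * x = x \<and> x * e = x"
proof
  assume "x \<in> corner e"
  then obtain y where y: "x = e * y * e" unfolding corner_def by auto
  show "e * x = x \<and> x * e = x"
    unfolding y using assms by (metis mult.assoc)
next
  assume "e * x = x \<and> x * e = x"
  then show "x \<in> corner e" using cornerI[of e x] by simp
qed

text \<open>For the normalised element \<open>u\<close>, the square \<open>u * u\<close> is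
  idempotent, hence orthogonal to \<open>e - u * u\<close>; so \<open>u * u = e\<close>. Then
  \<open>e - u\<close> and \<open>e + u\<close> are orthogonal, and \<open>u\<close> is
  \<open>e\<close> or \<open>- e\<close>.\<close>

lemma minimal_projection_corner_selfadjoint:
  fixes e :: "'a::cstar_algebra"
  assumes e: "minimal_projection e" and x: "x \<in> corner e" "star x = x"
  shows "\<exists>r. x = r *\<^sub>R e"
proof (cases "x = 0")
  case True
  then have "x = 0 *\<^sub>R e" by simp
  then show ?thesis ..
next
  case False
  note e = minimal_projectionD[OF e]
  have ex: "e * x = x" "x * e = x" using x corner_projection[OF e(2)] by auto
  define u where "u = (1 / norm x) *\<^sub>R x"
  have u: "star u = u" "norm u = 1" "e * u = u" "u * e = u" and xu: "x = norm x *\<^sub>R u"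
    using False x ex by (simp_all add: u_def star_scaleR)
  have uc: "u \<in> corner e" using u corner_projection[OF e(2)] by auto
  have idem: "u * u * (u * u) = u * u"
    using u orthogonal_free_mono[OF corner_subset[OF uc] e(5)]
    by (intro orthogonal_free_imp_idempotent_square)
  have e_mem: "y \<in> corner e" if "e * y = y" "y * e = y" for y
    using that corner_projection[OF e(2)] by auto
  have euu: "e * (u * u) = u * u" "u * (u * e) = u * u"
    using u by (metis mult.assoc)+
  have free: "a = 0 \<or> b = 0" if "a * b = 0" "star a = a" "star b = b"
    "e * a = a" "a * e = a" "e * b = b" "b * e = b" for a b
    using e(5) that e_mem unfolding orthogonal_free_def by blast
  have "u * u = 0 \<or> e - u * u = 0"
    using u e idem euu by (intro free) (simp_all add: algebra_simps star_diff star_mult)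
  moreover have "u * u \<noteq> 0" using u by (metis norm_square_selfadjoint norm_zero power_one zero_neq_one)
  ultimately have uu: "u * u = e" by simp
  have "e - u = 0 \<or> e + u = 0"
    using u e uu by (intro free) (simp_all add: algebra_simps star_diff star_add)
  then have "u = 1 *\<^sub>R e \<or> u = (-1) *\<^sub>R e" by (auto simp: eq_neg_iff_add_eq_0 add.commute)
  then show ?thesis using xu by (metis scaleR_scaleR)
qed

text \<open>Multiples of the real and the imaginary part of \<open>x\<close> lie in the corner, so
  the self-adjoint case applies to both.\<close>

lemma minimal_projection_corner:
  fixes e :: "'a::cstar_algebra"
  assumes e: "minimal_projection e" and x: "x \<in> corner e"
  shows "\<exists>c. x = c *\<^sub>C e"
proof -
  note e' = minimal_projectionD[OF e]
  have ex: "e * x = x" "x * e = x" using x corner_projection[OF e'(2)] by auto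
  have ex': "e * star x = star x" "star x * e = star x"
    using ex e'(1) by (metis star_mult)+
  have "x + star x \<in> corner e" "\<i> *\<^sub>C (x - star x) \<in> corner e"
    unfolding corner_projection[OF e'(2)] using ex ex'
    by (simp_all add: algebra_simps mult_scaleC_left mult_scaleC_right)
  moreover have "star (x + star x) = x + star x" "star (\<i> *\<^sub>C (x - star x)) = \<i> *\<^sub>C (x - star x)"
    by (simp_all add: star_add star_diff star_scaleC star_star algebra_simps
        complex_vector.scale_right_diff_distrib)
  ultimately obtain a b where ab: "x + star x = a *\<^sub>R e" "\<i> *\<^sub>C (x - star x) = b *\<^sub>R e"
    using minimal_projection_corner_selfadjoint[OF e] by metis
  have "x - star x = (- \<i>) *\<^sub>C \<i> *\<^sub>C (x - star x)"
    by (simp only: scaleC_scaleC) (simp add: scaleC_one)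
  also have "\<dots> = (- \<i> * of_real b) *\<^sub>C e"
    unfolding ab(2) by (simp only: scaleR_scaleC scaleC_scaleC)
  finally have "(x + star x) + (x - star x) = (of_real a + (- \<i> * of_real b)) *\<^sub>C e"
    by (simp only: ab(1) scaleR_scaleC scaleC_add_left)
  moreover have "(x + star x) + (x - star x) = 2 *\<^sub>C x"
    using scaleC_add_left[of 1 1 x] by (simp add: scaleC_one)
  ultimately have "(1/2) *\<^sub>C 2 *\<^sub>C x = (1/2) *\<^sub>C (of_real a + (- \<i> * of_real b)) *\<^sub>C e"
    by simp
  then have "x = ((1/2) * (of_real a + (- \<i> * of_real b))) *\<^sub>C e"
    by (simp only: scaleC_scaleC) (simp add: scaleC_one)
  then show ?thesis ..
qed

text \<open>For \<open>x \<noteq> 0\<close> in \<open>e A f\<close>, both \<open>x x\<^sup>*\<close> and \<open>x\<^sup>* y\<close> are scalars in their corners, so \<open>y\<close> is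
  a multiple of \<open>x\<close>.\<close>

lemma minimal_projection_off_corner:
  fixes e f :: "'a::cstar_algebra"
  assumes e: "minimal_projection e" and f: "minimal_projection f"
  shows "\<exists>x. \<forall>y. \<exists>c. e * y * f = c *\<^sub>C x"
proof (cases "\<forall>y. e * y * f = 0")
  case True
  then have "e * y * f = 0 *\<^sub>C 0" for y by simp
  then show ?thesis by blast
next
  case False
  note e' = minimal_projectionD[OF e] and f' = minimal_projectionD[OF f]
  from False obtain z where z: "e * z * f \<noteq> 0" by blast
  define x where "x = e * z * f"
  have ex: "e * x = x" "x * f = x" by (simp_all add: x_def mult.assoc e' f')
  have sx: "star x * e = star x" "f * star x = star x"
    using ex e' f' by (metis star_mult)+
  have "x * star x \<in> corner e"
    unfolding corner_projection[OF e'(2)] using ex sx by (metis mult.assoc)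
  then obtain d where d: "x * star x = d *\<^sub>C e"
    using minimal_projection_corner[OF e] by blast
  have "x * star x \<noteq> 0"
    using z star_mult_self_eq_0_iff[of "star x"] by (metis x_def star_star star_zero)
  then have d0: "d \<noteq> 0" using d by auto
  have "\<exists>c. e * y * f = c *\<^sub>C x" for y
  proof -
    define w where "w = e * y * f"
    have ew: "e * w = w" "w * f = w" by (simp_all add: w_def mult.assoc e' f')
    have "star x * w \<in> corner f"
      unfolding corner_projection[OF f'(2)] using ew sx by (metis mult.assoc)
    then obtain c where c: "star x * w = c *\<^sub>C f"
      using minimal_projection_corner[OF f] by blast
    have "d *\<^sub>C w = x * star x * w"
      using ew by (simp add: d mult_scaleC_left)
    also have "\<dots> = c *\<^sub>C x"
      using c ex by (simp add: mult.assoc mult_scaleC_right)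
    finally have "(1/d) *\<^sub>C d *\<^sub>C w = (1/d) *\<^sub>C c *\<^sub>C x" by simp
    then have "w = (1/d * c) *\<^sub>C x" using d0 by (simp add: scaleC_scaleC scaleC_one)
    then show ?thesis unfolding w_def ..
  qed
  then show ?thesis by blast
qed

section \<open>Orthogonal sequences\<close>

definition orthogonal_seq :: "(nat \<Rightarrow> 'a::cstar_algebra) \<Rightarrow> bool" where
  "orthogonal_seq b \<longleftrightarrow>
     (\<forall>i. star (b i) = b i \<and> b i \<noteq> 0) \<and> (\<forall>i j. i \<noteq> j \<longrightarrow> b i * b j = 0)"

text \<open>Otherwise every corner inside \<open>corner b\<close> can be split forever: at each
  stage one orthogonal element \<open>c n\<close> is set aside and the other, \<open>d n\<close>, is
  split again. The elements set aside form an orthogonal sequence.\<close>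

lemma minimal_projection_exists:
  fixes b :: "'a::cstar_algebra"
  assumes no_seq: "\<nexists>c :: nat \<Rightarrow> 'a. orthogonal_seq c" and b: "star b = b" "b \<noteq> 0"
  obtains e where "minimal_projection e" "e \<in> corner b"
proof -
  have "\<exists>m. star m = m \<and> m \<noteq> 0 \<and> corner m \<subseteq> corner b \<and> orthogonal_free (corner m)"
  proof (rule ccontr)
    assume neg: "\<not> ?thesis"
    define P where "P = (\<lambda>p :: 'a \<times> 'a. star (fst p) = fst p \<and> fst p \<noteq> 0 \<and> star (snd p) = snd p \<and>
      snd p \<noteq> 0 \<and> fst p * snd p = 0 \<and> corner (snd p) \<subseteq> corner b)"
    define Q where "Q = (\<lambda>(p :: 'a \<times> 'a) (q :: 'a \<times> 'a). fst q \<in> corner (snd p) \<and> snd q \<in> corner (snd p))"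
    have split: "\<exists>q. P q \<and> fst q \<in> corner d \<and> snd q \<in> corner d"
      if d: "star d = d" "d \<noteq> 0" "corner d \<subseteq> corner b" for d
    proof -
      have "\<not> orthogonal_free (corner d)" using neg d by blast
      then obtain x y where xy: "x \<in> corner d" "y \<in> corner d" "star x = x" "star y = y"
        "x * y = 0" "x \<noteq> 0" "y \<noteq> 0"
        unfolding orthogonal_free_def by blast
      have "corner y \<subseteq> corner b" using corner_subset[OF xy(2)] d(3) by blast
      then have "P (x, y)" using xy by (simp add: P_def)
      with xy show ?thesis by (intro exI[of _ "(x, y)"]) simp
    qed
    have "\<exists>f. \<forall>n. P (f n) \<and> Q (f n) (f (Suc n))"
    proof (rule dependent_nat_choice)
      show "\<exists>q. P q" using split[of b] b by blast
      show "\<exists>q. P q \<and> Q p q" if "P p" for p and n :: nat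
        using split[of "snd p"] that unfolding P_def Q_def by blast
    qed
    then obtain f where f: "\<And>n. P (f n)" "\<And>n. Q (f n) (f (Suc n))" by blast
    define c where "c n = fst (f n)" for n
    define d where "d n = snd (f n)" for n
    have d_step: "d (Suc n) \<in> corner (d n)" and c_step: "c (Suc n) \<in> corner (d n)" for n
      using f(2)[of n] by (simp_all add: Q_def c_def d_def)
    have d_mono: "corner (d n) \<subseteq> corner (d m)" if "m \<le> n" for m n
      using that by (induction n rule: dec_induct) (use corner_subset d_step in blast)+
    have cd: "c n * d n = 0" and sc: "star (c n) = c n" and c0: "c n \<noteq> 0" for n
      using f(1)[of n] by (simp_all add: P_def c_def d_def)
    \<comment> \<open>Every later \<open>c n\<close> lies in \<open>corner (d m)\<close>, which
      \<open>c m\<close> annihilates from the left; the other order follows by taking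
      adjoints.\<close>
    have lt: "c m * c n = 0" if "m < n" for m n
    proof -
      from that obtain k where k: "n = Suc k" "m \<le> k"
        by (metis less_Suc_eq_le less_imp_Suc_add le_add1)
      then have "c n \<in> corner (d m)" using c_step d_mono by blast
      then show ?thesis using cd[of m] by (rule corner_orthogonal')
    qed
    have "c m * c n = 0" if "m \<noteq> n" for m n
      using lt[of m n] lt[of n m] that sc by (metis linorder_neqE_nat star_mult star_zero)
    then have "orthogonal_seq c" unfolding orthogonal_seq_def using sc c0 by blast
    with no_seq show False by blast
  qed
  then obtain m where "star m = m" "m \<noteq> 0" "corner m \<subseteq> corner b" "orthogonal_free (corner m)"
    by blast
  then show ?thesis
    using that by (metis orthogonal_free_imp_minimal_projection subsetD)
qed

section \<open>Maximal orthogonal families and the resulting finite spanning set\<close>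

definition orthogonal_projections :: "'a::cstar_algebra set \<Rightarrow> bool" where
  "orthogonal_projections F \<longleftrightarrow>
     (\<forall>e\<in>F. minimal_projection e) \<and> (\<forall>e\<in>F. \<forall>f\<in>F. e \<noteq> f \<longrightarrow> e * f = 0)"

lemma finite_orthogonal_projections:
  fixes F :: "'a::cstar_algebra set"
  assumes no_seq: "\<nexists>c :: nat \<Rightarrow> 'a. orthogonal_seq c" and F: "orthogonal_projections F"
  shows "finite F"
proof (rule ccontr)
  assume "infinite F"
  then obtain c :: "nat \<Rightarrow> 'a" where c: "inj c" "range c \<subseteq> F"
    using infinite_countable_subset by blast
  have "c i \<in> F" for i using c(2) by blast
  moreover have "c i \<noteq> c j" if "i \<noteq> j" for i j using that c(1) by (auto dest: injD)
  ultimately have "orthogonal_seq c"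
    using F unfolding orthogonal_seq_def orthogonal_projections_def minimal_projection_def
    by simp
  with no_seq show False by blast
qed

text \<open>If the defect \<open>b = 1 - \<Sum>F\<close> were nonzero, its corner would contain a
  minimal projection \<open>p\<close> orthogonal to all of \<open>F\<close>. Maximality puts
  \<open>p\<close> into \<open>F\<close>, so \<open>p\<close> is orthogonal to itself.\<close>

lemma sum_orthogonal_projections_eq_one:
  fixes F :: "'a::cstar_algebra set"
  assumes no_seq: "\<nexists>c :: nat \<Rightarrow> 'a. orthogonal_seq c" and F: "orthogonal_projections F"
    and maximal: "\<And>G. orthogonal_projections G \<Longrightarrow> F \<subseteq> G \<Longrightarrow> G = F"
  shows "\<Sum>F = 1"
proof (rule ccontr)
  assume ne: "\<Sum>F \<noteq> 1"
  have fin: "finite F" by (rule finite_orthogonal_projections[OF no_seq F])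
  define b where "b = 1 - \<Sum>F"
  have proj: "star e = e" "e * e = e" "e \<noteq> 0" if "e \<in> F" for e
    using F that unfolding orthogonal_projections_def minimal_projection_def by auto
  have sb: "star b = b" using proj by (simp add: b_def star_diff star_sum)
  have be: "b * e = 0" if "e \<in> F" for e
  proof -
    have "\<Sum>F * e = (\<Sum>f\<in>F. if f = e then e else 0)"
      unfolding sum_distrib_right
      using F that proj(2) unfolding orthogonal_projections_def by (intro sum.cong) auto
    also have "\<dots> = e" using fin that by simp
    finally show ?thesis by (simp add: b_def algebra_simps)
  qed
  have eb: "e * b = 0" if "e \<in> F" for e
    using be[OF that] sb proj(1)[OF that] by (metis star_mult star_zero)
  have "b \<noteq> 0" using ne by (simp add: b_def)
  then obtain p where p: "minimal_projection p" "p \<in> corner b"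
    using minimal_projection_exists[OF no_seq sb] by blast
  have pe: "p * e = 0" "e * p = 0" if "e \<in> F" for e
    using corner_orthogonal[OF p(2) be[OF that]] corner_orthogonal'[OF p(2) eb[OF that]] by auto
  have "orthogonal_projections (insert p F)"
    using F p(1) pe unfolding orthogonal_projections_def by auto
  then have "p \<in> F" using maximal[of "insert p F"] by blast
  then show False
    using pe minimal_projectionD(2,4)[OF p(1)] by metis
qed

text \<open>Zorn applies because orthogonality involves two elements at a time, and these lie in a
  common member of the chain.\<close>

lemma maximal_orthogonal_projections_exists:
  obtains F :: "'a::cstar_algebra set" where "orthogonal_projections F"
    "\<And>G. orthogonal_projections G \<Longrightarrow> F \<subseteq> G \<Longrightarrow> G = F"
proof -
  have "\<exists>M\<in>{F :: 'a set. orthogonal_projections F}. \<forall>X\<in>{F. orthogonal_projections F}. M \<subseteq> X \<longrightarrow> X = M"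
  proof (rule subset_Zorn')
    fix C :: "'a set set" assume C: "subset.chain {F. orthogonal_projections F} C"
    then have orth: "orthogonal_projections X" if "X \<in> C" for X
      using that by (auto simp: subset.chain_def)
    have "e * f = 0" if "X \<in> C" "Y \<in> C" "e \<in> X" "f \<in> Y" "e \<noteq> f" for e f X Y
      using subset.chain_total[OF C that(1,2)] orth that unfolding orthogonal_projections_def by blast
    then show "\<Union>C \<in> {F. orthogonal_projections F}"
      using orth unfolding orthogonal_projections_def by blast
  qed
  then show ?thesis using that by blast
qed

lemma cfinite_dimensional_if_no_orthogonal_seq:
  assumes no_seq: "\<nexists>c :: nat \<Rightarrow> 'a::cstar_algebra. orthogonal_seq c"
  shows "cfinite_dimensional (UNIV :: 'a set)"
proof -
  obtain F :: "'a set" where F: "orthogonal_projections F"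
    "\<And>G. orthogonal_projections G \<Longrightarrow> F \<subseteq> G \<Longrightarrow> G = F"
    using maximal_orthogonal_projections_exists by blast
  have sum1: "\<Sum>F = 1" using no_seq F by (rule sum_orthogonal_projections_eq_one)
  have fin: "finite F" by (rule finite_orthogonal_projections[OF no_seq F(1)])
  have "\<exists>x. \<forall>y. \<exists>c. e * y * f = c *\<^sub>C x" if "e \<in> F" "f \<in> F" for e f
    using F(1) that by (intro minimal_projection_off_corner) (auto simp: orthogonal_projections_def)
  then obtain g where g: "\<And>e f y. e \<in> F \<Longrightarrow> f \<in> F \<Longrightarrow> \<exists>c. e * y * f = c *\<^sub>C g e f"
    by metis
  define B where "B = (\<lambda>(e, f). g e f) ` (F \<times> F)"
  have "y \<in> cspan B" for y
  proof -
    \<comment> \<open>Peirce decomposition of \<open>y\<close>; one spanning vector per pair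
      \<open>(e, f)\<close> suffices.\<close>
    have "y = \<Sum>F * y * \<Sum>F" by (simp add: sum1)
    also have "\<dots> = (\<Sum>e\<in>F. \<Sum>f\<in>F. e * y * f)"
      by (simp only: sum_distrib_right sum_distrib_left) (rule sum.swap)
    also have "\<dots> \<in> cspan B"
    proof (intro complex_vector.span_sum)
      fix e f assume ef: "e \<in> F" "f \<in> F"
      then obtain c where "e * y * f = c *\<^sub>C g e f" using g by blast
      moreover have "g e f \<in> B" using ef by (auto simp: B_def)
      ultimately show "e * y * f \<in> cspan B"
        by (simp add: complex_vector.span_scale complex_vector.span_base)
    qed
    finally show ?thesis .
  qed
  moreover have "finite B" using fin by (simp add: B_def)
  ultimately show ?thesis unfolding cfinite_dimensional_def by blast
qed

section \<open>Chains of commutative subalgebras\<close>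

definition commutant :: "'a::cstar_algebra set \<Rightarrow> 'a set" where
  "commutant S = {x. \<forall>y\<in>S. x * y = y * x}"

text \<open>The bicommutant replaces the closed algebra generated by \<open>b\<close>. The scalar
  \<open>l\<close> must be the same for all indices in \<open>S\<close>, so enlarging
  \<open>S\<close> shrinks the set.\<close>

definition scalar_on :: "(nat \<Rightarrow> 'a::cstar_algebra) \<Rightarrow> nat set \<Rightarrow> 'a set" where
  "scalar_on b S =
     {x \<in> commutant (commutant (range b)). \<exists>l. \<forall>i\<in>S. x * b i = l *\<^sub>C b i}"

text \<open>The scalars of a convergent sequence can be read off at a single nonzero
  \<open>b j\<close>: there they form a Cauchy sequence, and their limit serves every index in
  \<open>S\<close>.\<close>

lemma closed_scalar_on:
  assumes b: "orthogonal_seq b"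
  shows "closed (scalar_on b S)"
  unfolding closed_sequential_limits
proof (intro allI impI, elim conjE)
  fix x l assume x: "\<forall>n. x n \<in> scalar_on b S" and lim: "x \<longlonglongrightarrow> l"
  have "l * y = y * l" if y: "y \<in> commutant (range b)" for y
  proof (rule LIMSEQ_unique)
    show "(\<lambda>n. x n * y) \<longlonglongrightarrow> l * y" by (intro tendsto_intros lim)
    have "x n * y = y * x n" for n
      using x y by (auto simp: scalar_on_def commutant_def)
    then show "(\<lambda>n. x n * y) \<longlonglongrightarrow> y * l" by (simp only:) (intro tendsto_intros lim)
  qed
  then have l: "l \<in> commutant (commutant (range b))" by (simp add: commutant_def[of "commutant (range b)"])
  have "\<forall>n. \<exists>d. \<forall>i\<in>S. x n * b i = d *\<^sub>C b i"
    using x by (auto simp: scalar_on_def)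
  from choice[OF this] obtain c where c: "\<And>n i. i \<in> S \<Longrightarrow> x n * b i = c n *\<^sub>C b i"
    by auto
  have "\<exists>d. \<forall>i\<in>S. l * b i = d *\<^sub>C b i"
  proof (cases "S = {}")
    case False
    then obtain j where j: "j \<in> S" by blast
    have bj: "norm (b j) > 0" using b by (simp add: orthogonal_seq_def)
    have "Cauchy (\<lambda>n. x n * b j)"
      by (rule LIMSEQ_imp_Cauchy[OF tendsto_mult[OF lim tendsto_const]])
    then have cau: "Cauchy (\<lambda>n. c n *\<^sub>C b j)" using c[OF j] by simp
    have "Cauchy c"
    proof (rule metric_CauchyI)
      fix e :: real assume "e > 0"
      then have "e * norm (b j) > 0" using bj by simp
      then obtain M where M: "\<And>m n. m \<ge> M \<Longrightarrow> n \<ge> M \<Longrightarrow> dist (c m *\<^sub>C b j) (c n *\<^sub>C b j) < e * norm (b j)"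
        using cau unfolding Cauchy_def by blast
      then show "\<exists>M. \<forall>m\<ge>M. \<forall>n\<ge>M. dist (c m) (c n) < e"
        using bj
        by (auto simp: dist_norm norm_scaleC simp flip: complex_vector.scale_left_diff_distrib)
    qed
    then obtain d where d: "c \<longlonglongrightarrow> d" by (auto simp: Cauchy_convergent_iff convergent_def)
    have "l * b i = d *\<^sub>C b i" if i: "i \<in> S" for i
    proof (rule LIMSEQ_unique)
      show "(\<lambda>n. x n * b i) \<longlonglongrightarrow> l * b i" by (intro tendsto_intros lim)
      show "(\<lambda>n. x n * b i) \<longlonglongrightarrow> d *\<^sub>C b i" unfolding c[OF i] by (rule tendsto_scaleC[OF d])
    qed
    then show ?thesis by blast
  qed simp
  with l show "l \<in> scalar_on b S" unfolding scalar_on_def by (intro CollectI conjI)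
qed

text \<open>The \<open>b i\<close> commute with each other, so their range lies in its own
  commutant, and taking commutants reverses this inclusion. The second part makes the bicommutant
  commutative.\<close>

lemma range_subset_bicommutant:
  assumes "orthogonal_seq b"
  shows "range b \<subseteq> commutant (commutant (range b))"
    "commutant (commutant (range b)) \<subseteq> commutant (range b)"
proof -
  have comm: "b i * b j = b j * b i" for i j
    using assms by (cases "i = j") (simp_all add: orthogonal_seq_def)
  show "range b \<subseteq> commutant (commutant (range b))"
    by (auto simp: commutant_def)
  have "b i \<in> commutant (range b)" for i
    unfolding commutant_def mem_Collect_eq using comm by (intro ballI) (elim rangeE, simp only:)
  then have "x * b i = b i * x" if "x \<in> commutant (commutant (range b))" for x i
    using that by (simp add: commutant_def[of "commutant (range b)"])
  then show "commutant (commutant (range b)) \<subseteq> commutant (range b)"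
    by (intro subsetI) (simp add: commutant_def[of "range b"])
qed

lemma star_commutant:
  assumes "\<And>y. y \<in> S \<Longrightarrow> star y \<in> S" "x \<in> commutant S"
  shows "star x \<in> commutant S"
  using assms unfolding commutant_def mem_Collect_eq by (metis star_mult star_star)

lemma scalar_on_in_comm_subalgebras:
  assumes b: "orthogonal_seq b"
  shows "scalar_on b S \<in> comm_subalgebras"
proof -
  let ?M = "commutant (commutant (range b))"
  note sub = range_subset_bicommutant[OF b]
  have sb: "star (b i) = b i" for i using b by (simp add: orthogonal_seq_def)
  have comm: "x * y = y * x" if "x \<in> ?M" "y \<in> ?M" for x y
    using that(1) subsetD[OF sub(2) that(2)] by (simp add: commutant_def[of "commutant (range b)"])
  have zero: "0 \<in> scalar_on b S"
    unfolding scalar_on_def commutant_def by (auto intro!: exI[of _ 0])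
  have one: "1 \<in> scalar_on b S"
    unfolding scalar_on_def commutant_def by (auto intro!: exI[of _ 1] simp: scaleC_one)
  have add: "x + y \<in> scalar_on b S" if "x \<in> scalar_on b S" "y \<in> scalar_on b S" for x y
  proof -
    from that obtain l k where "\<forall>i\<in>S. x * b i = l *\<^sub>C b i" "\<forall>i\<in>S. y * b i = k *\<^sub>C b i"
      by (auto simp: scalar_on_def)
    then have "\<forall>i\<in>S. (x + y) * b i = (l + k) *\<^sub>C b i"
      by (simp add: distrib_right scaleC_add_left)
    moreover have "x + y \<in> ?M"
      using that by (simp add: scalar_on_def commutant_def distrib_left distrib_right)
    ultimately show ?thesis by (auto simp: scalar_on_def)
  qed
  have scale: "c *\<^sub>C x \<in> scalar_on b S" if "x \<in> scalar_on b S" for x c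
  proof -
    from that obtain l where "\<forall>i\<in>S. x * b i = l *\<^sub>C b i"
      by (auto simp: scalar_on_def)
    then have "\<forall>i\<in>S. (c *\<^sub>C x) * b i = (c * l) *\<^sub>C b i"
      by (simp add: mult_scaleC_left scaleC_scaleC)
    moreover have "c *\<^sub>C x \<in> ?M"
      using that by (simp add: scalar_on_def commutant_def mult_scaleC_left mult_scaleC_right)
    ultimately show ?thesis by (auto simp: scalar_on_def)
  qed
  have mult: "x * y \<in> scalar_on b S" if "x \<in> scalar_on b S" "y \<in> scalar_on b S" for x y
  proof -
    from that obtain l k where "\<forall>i\<in>S. x * b i = l *\<^sub>C b i" "\<forall>i\<in>S. y * b i = k *\<^sub>C b i"
      by (auto simp: scalar_on_def)
    then have "\<forall>i\<in>S. (x * y) * b i = (k * l) *\<^sub>C b i"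
      by (simp add: mult.assoc mult_scaleC_right scaleC_scaleC)
    moreover have "x * y \<in> ?M"
      using that unfolding scalar_on_def commutant_def[of "commutant (range b)"] mem_Collect_eq
      by (metis mult.assoc)
    ultimately show ?thesis by (auto simp: scalar_on_def)
  qed
  have star: "star x \<in> scalar_on b S" if x: "x \<in> scalar_on b S" for x
  proof -
    from x obtain l where l: "\<forall>i\<in>S. x * b i = l *\<^sub>C b i" and xM: "x \<in> ?M"
      by (auto simp: scalar_on_def)
    have "star x * b i = cnj l *\<^sub>C b i" if "i \<in> S" for i
    proof -
      \<comment> \<open>The adjoint exchanges the factors, so \<open>x\<close> must first be moved
        to the right of \<open>b i\<close>.\<close>
      have "b i * x = l *\<^sub>C b i" using comm[OF xM, of "b i"] subsetD[OF sub(1), of "b i"] l that by simp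
      then have "star (b i * x) = star (l *\<^sub>C b i)" by simp
      then show ?thesis by (simp add: star_mult star_scaleC sb)
    qed
    moreover have "star x \<in> ?M"
      using xM by (intro star_commutant) (auto simp: sb)
    ultimately show ?thesis by (auto simp: scalar_on_def)
  qed
  have "cstar_subalgebra (scalar_on b S)"
    unfolding cstar_subalgebra_def
    by (intro conjI ballI allI zero add scale mult star closed_scalar_on[OF b])
  then show ?thesis
    unfolding comm_subalgebras_def using one comm by (auto simp: scalar_on_def)
qed

lemma scalar_on_antimono: "S \<subseteq> T \<Longrightarrow> scalar_on b T \<subseteq> scalar_on b S"
  unfolding scalar_on_def by blast

lemma orthogonal_seq_mem_scalar_on:
  assumes b: "orthogonal_seq b" and "i \<notin> S"
  shows "b i \<in> scalar_on b S"
proof -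
  have "\<forall>j\<in>S. b i * b j = 0 *\<^sub>C b j"
    using assms unfolding orthogonal_seq_def by (metis complex_vector.scale_zero_left)
  then show ?thesis
    unfolding scalar_on_def using range_subset_bicommutant(1)[OF b] by blast
qed

text \<open>The index \<open>j\<close> forces the scalar to be 0, and then index \<open>i\<close>
  gives \<open>b i * b i = 0\<close>. One index would not do: a projection \<open>b i\<close> acts
  on itself as the scalar 1.\<close>

lemma orthogonal_seq_not_mem_scalar_on:
  assumes b: "orthogonal_seq b" and ij: "i \<in> S" "j \<in> S" "i \<noteq> j"
  shows "b i \<notin> scalar_on b S"
proof
  assume "b i \<in> scalar_on b S"
  then obtain l where l: "\<forall>k\<in>S. b i * b k = l *\<^sub>C b k" by (auto simp: scalar_on_def)
  then have "l *\<^sub>C b j = 0" using b ij by (metis orthogonal_seq_def)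
  then have "l = 0" using b by (auto simp: orthogonal_seq_def)
  then have "b i * b i = 0" using l ij by auto
  then show False using b by (simp add: orthogonal_seq_def selfadjoint_square_eq_0_iff)
qed

lemma noetherian_imp_no_orthogonal_seq:
  assumes "noetherian_poset (comm_subalgebras :: 'a::cstar_algebra set set)"
  shows "\<nexists>b :: nat \<Rightarrow> 'a. orthogonal_seq b"
proof
  assume "\<exists>b :: nat \<Rightarrow> 'a. orthogonal_seq b"
  then obtain b :: "nat \<Rightarrow> 'a" where b: "orthogonal_seq b" ..
  define C where "C n = scalar_on b {n..}" for n
  have "incseq C" unfolding C_def by (intro monoI scalar_on_antimono) auto
  then obtain n where n: "\<forall>k>n. C k = C n"
    using assms[unfolded noetherian_poset_def, rule_format, of C] scalar_on_in_comm_subalgebras[OF b]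
    by (auto simp: C_def)
  \<comment> \<open>\<open>b n\<close> acts as 0 on all later members, while \<open>{n..}\<close>
    contains both \<open>n\<close> and \<open>Suc n\<close>.\<close>
  have "b n \<in> C (Suc n)" unfolding C_def by (rule orthogonal_seq_mem_scalar_on[OF b]) simp
  moreover have "b n \<notin> C n"
    unfolding C_def by (rule orthogonal_seq_not_mem_scalar_on[OF b, of _ _ "Suc n"]) auto
  ultimately show False using n by blast
qed

lemma artinian_imp_no_orthogonal_seq:
  assumes "artinian_poset (comm_subalgebras :: 'a::cstar_algebra set set)"
  shows "\<nexists>b :: nat \<Rightarrow> 'a. orthogonal_seq b"
proof
  assume "\<exists>b :: nat \<Rightarrow> 'a. orthogonal_seq b"
  then obtain b :: "nat \<Rightarrow> 'a" where b: "orthogonal_seq b" ..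
  define C where "C n = scalar_on b {..n}" for n
  have "decseq C" unfolding C_def by (intro antimonoI scalar_on_antimono) auto
  then obtain n where n: "\<forall>k>n. C k = C n"
    using assms[unfolded artinian_poset_def, rule_format, of C] scalar_on_in_comm_subalgebras[OF b]
    by (auto simp: C_def)
  \<comment> \<open>The witness is \<open>b (Suc n)\<close> because \<open>{..Suc n}\<close> always
    has two indices, whereas \<open>{..0}\<close> has only one.\<close>
  have "b (Suc n) \<in> C n" unfolding C_def by (rule orthogonal_seq_mem_scalar_on[OF b]) simp
  moreover have "b (Suc n) \<notin> C (Suc n)"
    unfolding C_def by (rule orthogonal_seq_not_mem_scalar_on[OF b, of _ _ n]) auto
  ultimately show False using n by blast
qed

section \<open>Finite-dimensional algebras\<close>

lemma comm_subalgebras_subspace: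
  "C \<in> comm_subalgebras \<Longrightarrow> complex_vector.subspace C"
  by (auto simp: comm_subalgebras_def cstar_subalgebra_def complex_vector.subspace_def)

text \<open>Collects what the chain conditions need: dimension is bounded and monotone, and on
  nested subspaces its equality forces their equality.\<close>

lemma cfinite_dimensional_dim:
  assumes "cfinite_dimensional (UNIV :: 'a::cstar_algebra set)"
  obtains N where "\<And>U :: 'a set. complex_vector.dim U \<le> N"
    "\<And>U V :: 'a set. complex_vector.subspace U \<Longrightarrow> complex_vector.subspace V \<Longrightarrow> U \<subseteq> V \<Longrightarrow>
        complex_vector.dim U = complex_vector.dim V \<Longrightarrow> U = V"
    "\<And>U V :: 'a set. U \<subseteq> V \<Longrightarrow> complex_vector.dim U \<le> complex_vector.dim V"
proof -
  from assms obtain B :: "'a set" where B: "finite B" "cspan B = UNIV"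
    by (auto simp: cfinite_dimensional_def)
  obtain B' :: "'a set" where B': "B' \<subseteq> B" "complex_vector.independent B'" "B \<subseteq> cspan B'"
    using complex_vector.maximal_independent_subset[of B] by blast
  have span: "cspan B' = UNIV"
    using complex_vector.span_mono[OF B'(3)] B(2) by (simp add: complex_vector.span_span top.extremum_unique)
  interpret V: finite_dimensional_vector_space "scaleC :: complex \<Rightarrow> 'a \<Rightarrow> 'a" B'
    by unfold_locales (use B(1) B' span finite_subset in \<open>auto simp: cspan_def\<close>)
  show ?thesis
  proof (rule that)
    show "complex_vector.dim U \<le> complex_vector.dim (UNIV :: 'a set)" for U :: "'a set"
      by (rule V.dim_subset) simp
    show "U = V" if "complex_vector.subspace U" "complex_vector.subspace V" "U \<subseteq> V"
      "complex_vector.dim U = complex_vector.dim V" for U V :: "'a set"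
      using that by (intro V.subspace_dim_equal) simp_all
  qed (rule V.dim_subset)
qed

lemma mono_bounded_nat_stabilizes:
  fixes f :: "nat \<Rightarrow> nat"
  assumes "mono f" "\<And>n. f n \<le> N"
  shows "\<exists>n. \<forall>k>n. f k = f n"
proof -
  have "finite (range f)" using assms(2) by (meson finite_atMost finite_subset image_subsetI atMost_iff)
  then obtain n where n: "Max (range f) = f n"
    using Max_in[of "range f"] by blast
  have "f k = f n" if "k > n" for k
    using Max_ge[of "range f" "f k"] \<open>finite (range f)\<close> n monoD[OF assms(1), of n k] that by simp
  then show ?thesis by blast
qed

lemma cfinite_dimensional_imp_noetherian:
  assumes "cfinite_dimensional (UNIV :: 'a::cstar_algebra set)"
  shows "noetherian_poset (comm_subalgebras :: 'a set set)"
  unfolding noetherian_poset_def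
proof (intro allI impI, elim conjE)
  fix C :: "nat \<Rightarrow> 'a set"
  assume C: "\<forall>i. C i \<in> comm_subalgebras" "incseq C"
  obtain N where N: "\<And>U :: 'a set. complex_vector.dim U \<le> N"
    "\<And>U V :: 'a set. complex_vector.subspace U \<Longrightarrow> complex_vector.subspace V \<Longrightarrow> U \<subseteq> V \<Longrightarrow>
        complex_vector.dim U = complex_vector.dim V \<Longrightarrow> U = V"
    "\<And>U V :: 'a set. U \<subseteq> V \<Longrightarrow> complex_vector.dim U \<le> complex_vector.dim V"
    using cfinite_dimensional_dim[OF assms] by metis
  have "mono (\<lambda>n. complex_vector.dim (C n))"
    using C(2) by (intro monoI N(3)) (simp add: monoD)
  then obtain n where "\<forall>k>n. complex_vector.dim (C k) = complex_vector.dim (C n)"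
    using mono_bounded_nat_stabilizes[of "\<lambda>n. complex_vector.dim (C n)" N] N(1) by blast
  then have "C n = C k" if "k > n" for k
    using that C by (intro N(2)) (auto simp: comm_subalgebras_subspace incseq_def less_imp_le subsetD)
  then show "\<exists>n. \<forall>k>n. C k = C n" by metis
qed

lemma cfinite_dimensional_imp_artinian:
  assumes "cfinite_dimensional (UNIV :: 'a::cstar_algebra set)"
  shows "artinian_poset (comm_subalgebras :: 'a set set)"
  unfolding artinian_poset_def
proof (intro allI impI, elim conjE)
  fix C :: "nat \<Rightarrow> 'a set"
  assume C: "\<forall>i. C i \<in> comm_subalgebras" "decseq C"
  obtain N where N: "\<And>U :: 'a set. complex_vector.dim U \<le> N"
    "\<And>U V :: 'a set. complex_vector.subspace U \<Longrightarrow> complex_vector.subspace V \<Longrightarrow> U \<subseteq> V \<Longrightarrow>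
        complex_vector.dim U = complex_vector.dim V \<Longrightarrow> U = V"
    "\<And>U V :: 'a set. U \<subseteq> V \<Longrightarrow> complex_vector.dim U \<le> complex_vector.dim V"
    using cfinite_dimensional_dim[OF assms] by metis
  have dec: "complex_vector.dim (C m) \<le> complex_vector.dim (C n)" if "n \<le> m" for m n
    using C(2) that by (intro N(3)) (simp add: decseq_def)
  \<comment> \<open>The complementary quantity increases, which reduces the descending case to the
    ascending one; the bound \<open>N\<close> makes the truncated subtraction reversible.\<close>
  have "mono (\<lambda>n. N - complex_vector.dim (C n))"
    by (intro monoI diff_le_mono2 dec)
  then obtain n where "\<forall>k>n. N - complex_vector.dim (C k) = N - complex_vector.dim (C n)"
    using mono_bounded_nat_stabilizes[of "\<lambda>n. N - complex_vector.dim (C n)" N] by auto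
  then have "complex_vector.dim (C k) = complex_vector.dim (C n)" if "k > n" for k
    using that N(1) by (metis diff_diff_cancel)
  then have "C k = C n" if "k > n" for k
    using that C by (intro N(2)) (auto simp: comm_subalgebras_subspace decseq_def less_imp_le subsetD)
  then show "\<exists>n. \<forall>k>n. C k = C n" by metis
qed

theorem proposition5:
  shows "(cfinite_dimensional (UNIV :: 'a::cstar_algebra set) \<longleftrightarrow>
            artinian_poset (comm_subalgebras :: 'a set set)) \<and>
         (artinian_poset (comm_subalgebras :: 'a set set) \<longleftrightarrow>
            noetherian_poset (comm_subalgebras :: 'a set set)) \<and>
         (noetherian_poset (comm_subalgebras :: 'a set set) \<longleftrightarrow>
            cfinite_dimensional (UNIV :: 'a set))"
  using cfinite_dimensional_imp_artinian[where ?'a = 'a]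
    cfinite_dimensional_imp_noetherian[where ?'a = 'a]
    cfinite_dimensional_if_no_orthogonal_seq[where ?'a = 'a]
    artinian_imp_no_orthogonal_seq[where ?'a = 'a]
    noetherian_imp_no_orthogonal_seq[where ?'a = 'a]
  by blast

end
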